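(* Let $a\in\mathcal{A}$, let $\Gamma=\Gamma_a$ be a hyperbolic set for $f_a$, let $z=z(a)$ be any point in $\Gamma$, and for parameters $b$ near $a$ let $\Gamma_b$ and $z(b)$ be the continuations of $\Gamma$ and $z$. Then $$a\in\mathrm{cl}\{\,b \mid f_b^N(0)=z(b)\text{ for some }N=N(b)\,\},$$ where $\mathrm{cl}$ denotes closure.
   Context: The quadratic family is $f_a(x)=1-ax^2$, $0<a\le 2$, acting on $I=[-1,1]$; its critical point is $0$. A hyperbolic set $\Gamma_a$ for $f_a$ is a compact invariant set, $f_a(\Gamma_a)=\Gamma_a$, on which $f_a$ is uniformly expanding (there are $C>0$, $\kappa>1$ with $|Df_a^n(x)|\ge C\kappa^n$ for all $x\in\Gamma_a$, $n\ge1$). Its continuation is the family of hyperbolic sets $\Gamma_b$ of $f_b$, defined for $b$ in a neighborhood of $a$, given by $\Gamma_b=h_b(\Gamma_a)$, where $h_b$ are homeomorphisms depending continuously on $b$ with $h_a=\mathrm{id}$ and $h_b\circ f_a=f_b\circ h_b$ on $\Gamma_a$; the continuation of $z\in\Gamma_a$ is $z(b)=h_b(z)$. An acip is an absolutely continuous invariant probability measure. The set $\mathcal{A}\subset(0,2]$ is the positive-measure set of parameters constructed by Benedicks and Carleson (On iterations of $1-ax^2$, Ann. of Math. 1985; The dynamics of the Hénon map, Ann. of Math. 1991). It has $2$ as a Lebesgue density point, and for every $a\in\mathcal{A}$ the Lyapunov exponent of $f_a$ at the critical value is positive and $f_a$ admits an acip $\mu_a$ with density in $L^p$ for all $1\le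 p<2$. The structure of the construction is as follows. Constants $\lambda>0$, $\alpha>0$ (suitably small), $\delta>0$ (sufficiently small) are fixed, and everything takes place in a sufficiently small one-sided parameter neighborhood of $2$. Put $I^*=(-\delta,\delta)$; for integers $\mu$ with $|\mu|\ge-\log\delta$ let $I_\mu=[e^{-(\mu+1)},e^{-\mu})$ if $\mu>0$ and $I_\mu=-I_{-\mu}$ if $\mu<0$; subdivide $I_\mu$ into $\mu^2$ intervals $I_{\mu\nu}$, $1\le\nu\le\mu^2$, of equal length, and let $I_{\mu\nu}^+$ be the union of $I_{\mu\nu}$ and its two nearest neighbors. Let $\xi_n(a)=f_a^n(0)$. Then $\mathcal{A}=\bigcap_{n\ge0}A_n$ for a decreasing sequence of sets $A_n$, where every $a\in A_n$ satisfies $|Df_a^j(f_a(0))|\ge e^{\lambda j}$ for all $j\le n$ and $|f_a^j(0)|\ge e^{-\alpha j}$ for all $1\le j\le n$. Each $A_n$ carries a partition $\mathcal{P}_n$ into intervals; $\omega_n(a)$ is the element of $\mathcal{P}_n$ containing $a$, the $\omega_n(a)$ are nested, and $\{a\}=\bigcap_n\omega_n(a)$ for $a\in\mathcal{A}$. Each $a\in\mathcal{A}$ has an infinite increasing sequence $n_k=n_k(a)$ of essential free return times such that, with $\omega_n=\omega_n(a)$: $\omega_n=\omega_{n_k}$ for $n_k\le n<n_{k+1}$; if $n\le n_k$ and $\xi_n(\omega_{n_k})\cap I^*\ne\emptyset$ then $\xi_n(\omega_{n_k})\subset$ some $I_{\mu\nu}^+$; and $I_{\mu\nu}\subset\xi_{n_k}(\omega_{n_k})\subset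 I_{\mu\nu}^+$ for some $I_{\mu\nu}$. After a free return of a parameter interval $\omega$ at time $n$ with $\xi_n(\omega)\subset I_{\mu\nu}^+$, there follows a bound period lasting as long as $\left|\bigcup_{b\in\omega}f_b^j(-e^{-|\mu|},e^{-|\mu|})\right|\le e^{-2\alpha j}$. If $p_k$ is the length of the bound period after $n_k$, then $n_{k+1}$ is the smallest $j\ge n_k+p_k$ such that $\xi_j(\omega_{n_k})$ contains some $I_{\mu\nu}\subset I^*$; returns to $I^*$ at times $j$ with $n_k+p_k\le j<n_{k+1}$ at which no $I_{\mu\nu}$ is covered are called inessential free returns and are also followed by bound periods. An essential free return time $n_k$ is an escape-time of $a$ if $\xi_{n_k}(\omega_{n_k-1})$ intersects $(-\delta^2,\delta^2)$ and $|\xi_{n_k}(\omega_{n_k-1})|\ge\delta$. Besides the exclusion of parameters violating $|f_a^n(0)|\ge e^{-\alpha n}$, a second exclusion rule discards parameters that on average wait too long for escape-times; in particular each $a\in\mathcal{A}$ has infinitely many escape-times. *)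

theory Defs
  imports "HOL-Analysis.Analysis"
begin

definition quad :: "real \<Rightarrow> real \<Rightarrow> real" where
  "quad a x = 1 - a * x\<^sup>2"

definition xi :: "nat \<Rightarrow> real \<Rightarrow> real" where
  "xi n a = (quad a ^^ n) 0"


section \<open>Hyperbolic sets and their continuations\<close>

definition hyperbolic_set :: "real \<Rightarrow> real set \<Rightarrow> bool" where
  "hyperbolic_set a \<Gamma> \<longleftrightarrow>
     \<Gamma> \<subseteq> {-1..1} \<and> compact \<Gamma> \<and> quad a ` \<Gamma> = \<Gamma> \<and>
     (\<exists>C>0. \<exists>\<kappa>>1. \<forall>x\<in>\<Gamma>. \<forall>n\<ge>1. \<bar>deriv (quad a ^^ n) x\<bar> \<ge> C * \<kappa> ^ n)"

text \<open>Since \<open>\<Gamma>\<close> is compact, joint continuity of \<open>(b, x) \<mapsto> h b x\<close> says precisely that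
  \<open>b \<mapsto> h b\<close> is continuous for uniform convergence on \<open>\<Gamma>\<close>. The neighbourhood \<open>U\<close> of \<open>a\<close> is
  taken in the parameter space \<open>(0, 2]\<close>.\<close>

definition continuation ::
  "real \<Rightarrow> real set \<Rightarrow> real set \<Rightarrow> (real \<Rightarrow> real \<Rightarrow> real) \<Rightarrow> bool" where
  "continuation a \<Gamma> U h \<longleftrightarrow>
     openin (top_of_set {0<..2}) U \<and> a \<in> U \<and>
     continuous_on (U \<times> \<Gamma>) (\<lambda>(b, x). h b x) \<and>
     (\<forall>x\<in>\<Gamma>. h a x = x) \<and>
     (\<forall>b\<in>U. (\<exists>g. homeomorphism \<Gamma> (h b ` \<Gamma>) (h b) g) \<and>
            hyperbolic_set b (h b ` \<Gamma>) \<and>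
            (\<forall>x\<in>\<Gamma>. h b (quad a x) = quad b (h b x)))"


section \<open>The subdivision of the critical neighbourhood\<close>

text \<open>\<open>cell \<mu> \<nu>\<close> is the \<open>\<nu>\<close>-th of the \<open>\<mu>\<^sup>2\<close> subintervals of equal length of
  \<open>[exp (- (\<mu> + 1)), exp (- \<mu>))\<close> if \<open>\<mu> > 0\<close>; for \<open>\<mu> < 0\<close> it is a mirror image.\<close>

definition pos_cell :: "int \<Rightarrow> nat \<Rightarrow> real set" where
  "pos_cell \<mu> \<nu> =
     (let l = exp (- (of_int \<mu> + 1)); w = (exp (- of_int \<mu>) - l) / (of_int \<mu>)\<^sup>2
      in {l + (real \<nu> - 1) * w ..< l + real \<nu> * w})"

definition cell :: "int \<Rightarrow> nat \<Rightarrow> real set" where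
  "cell \<mu> \<nu> = (if \<mu> > 0 then pos_cell \<mu> \<nu> else uminus ` pos_cell (- \<mu>) \<nu>)"

definition cells :: "real set set" where
  "cells = {cell \<mu> \<nu> | \<mu> \<nu>. \<mu> \<noteq> 0 \<and> 1 \<le> \<nu> \<and> int \<nu> \<le> \<mu>\<^sup>2}"

text \<open>The cells inside \<open>(- \<delta>, \<delta>)\<close>.\<close>

definition cell_index :: "real \<Rightarrow> int \<Rightarrow> nat \<Rightarrow> bool" where
  "cell_index \<delta> \<mu> \<nu> \<longleftrightarrow>
     \<mu> \<noteq> 0 \<and> of_int \<bar>\<mu>\<bar> \<ge> - ln \<delta> \<and> 1 \<le> \<nu> \<and> int \<nu> \<le> \<mu>\<^sup>2"

text \<open>A cell together with the two cells adjacent to it. Neighbours are taken in the family of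
  all cells, so that the outermost cells of \<open>(- \<delta>, \<delta>)\<close> also have two of them.\<close>

definition cell_plus :: "int \<Rightarrow> nat \<Rightarrow> real set" where
  "cell_plus \<mu> \<nu> =
     cell \<mu> \<nu> \<union> \<Union>{J \<in> cells. J \<noteq> cell \<mu> \<nu> \<and> closure J \<inter> closure (cell \<mu> \<nu>) \<noteq> {}}"


section \<open>Benedicks--Carleson parameter sets\<close>

abbreviation len :: "real set \<Rightarrow> real" where
  "len S \<equiv> measure lborel S"

definition part_elem :: "real set set \<Rightarrow> real \<Rightarrow> real set" where
  "part_elem Q a = (THE \<omega>. \<omega> \<in> Q \<and> a \<in> \<omega>)"

text \<open>A return of \<open>\<omega>\<close> at time \<open>n\<close> is bound at the times \<open>n + j\<close> with \<open>j < p\<close>; time \<open>n + p\<close> is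
  the first free one.\<close>

definition bound_period_length :: "real \<Rightarrow> real set \<Rightarrow> int \<Rightarrow> nat \<Rightarrow> bool" where
  "bound_period_length \<alpha> \<omega> \<mu> p \<longleftrightarrow>
     (let r = exp (- of_int \<bar>\<mu>\<bar>);
          bound = (\<lambda>j. len (\<Union>b\<in>\<omega>. (quad b ^^ j) ` {-r<..<r}) \<le> exp (- 2 * \<alpha> * real j))
      in (\<forall>j<p. bound j) \<and> \<not> bound p)"

definition covers_cell :: "real \<Rightarrow> real set \<Rightarrow> bool" where
  "covers_cell \<delta> S \<longleftrightarrow> (\<exists>\<mu> \<nu>. cell_index \<delta> \<mu> \<nu> \<and> cell \<mu> \<nu> \<subseteq> S)"

text \<open>To be applied to the partition element \<open>\<omega>\<close> just before the essential free return at
  time \<open>n\<close>, before it is subdivided.\<close>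

definition escapes :: "real \<Rightarrow> real set \<Rightarrow> nat \<Rightarrow> bool" where
  "escapes \<delta> \<omega> n \<longleftrightarrow>
     xi n ` \<omega> \<inter> {- (\<delta>\<^sup>2) <..< \<delta>\<^sup>2} \<noteq> {} \<and> len (xi n ` \<omega>) \<ge> \<delta>"

text \<open>\<open>A\<close> is the set of good parameters, \<open>An\<close> and \<open>P\<close> are the decreasing sets and their
  partitions. For \<open>a \<in> A\<close>, \<open>ret a k\<close> is the \<open>k\<close>-th essential free return time, \<open>mu a k\<close> and
  \<open>nu a k\<close> are the indices of the cell it hits, and \<open>p a k\<close> is the length of the subsequent
  bound period. All parameters lie within \<open>eps\<close> of \<open>2\<close>.\<close>

locale benedicks_carleson =
  fixes lam alpha delta eps :: real
    and A :: "real set"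
    and An :: "nat \<Rightarrow> real set"
    and P :: "nat \<Rightarrow> real set set"
    and ret :: "real \<Rightarrow> nat \<Rightarrow> nat"
    and mu :: "real \<Rightarrow> nat \<Rightarrow> int"
    and nu :: "real \<Rightarrow> nat \<Rightarrow> nat"
    and p :: "real \<Rightarrow> nat \<Rightarrow> nat"
  assumes A_eq: "A = (\<Inter>n. An n)"
    and An_decseq: "decseq An"
    and An_near_2: "An n \<subseteq> {0<..2} \<inter> {2 - eps<..2}"
    and expansion: "a \<in> An n \<Longrightarrow> j \<le> n \<Longrightarrow>
      \<bar>deriv (quad a ^^ j) (quad a 0)\<bar> \<ge> exp (lam * real j)"
    and slow_recurrence: "a \<in> An n \<Longrightarrow> 1 \<le> j \<Longrightarrow> j \<le> n \<Longrightarrow>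
      \<bar>(quad a ^^ j) 0\<bar> \<ge> exp (- alpha * real j)"
    and partition: "partition_on (An n) (P n)"
    and partition_intervals: "\<omega> \<in> P n \<Longrightarrow> is_interval \<omega>"
    and nested: "a \<in> An (Suc n) \<Longrightarrow> part_elem (P (Suc n)) a \<subseteq> part_elem (P n) a"
    and shrinking: "a \<in> A \<Longrightarrow> (\<Inter>n. part_elem (P n) a) = {a}"
    and ret_strict_mono: "a \<in> A \<Longrightarrow> strict_mono (ret a)"
    and constant_between: "a \<in> A \<Longrightarrow> ret a k \<le> n \<Longrightarrow> n < ret a (Suc k) \<Longrightarrow>
      part_elem (P n) a = part_elem (P (ret a k)) a"
    \<comment> \<open>\<open>n = 0\<close> has to be left out because \<open>xi 0\<close> is identically \<open>0\<close>, which lies in no cell.\<close>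
    and returns_small: "a \<in> A \<Longrightarrow> 1 \<le> n \<Longrightarrow> n \<le> ret a k \<Longrightarrow>
      xi n ` part_elem (P (ret a k)) a \<inter> {- delta<..<delta} \<noteq> {} \<Longrightarrow>
      \<exists>\<mu> \<nu>. cell_index delta \<mu> \<nu> \<and> xi n ` part_elem (P (ret a k)) a \<subseteq> cell_plus \<mu> \<nu>"
    and ret_cell: "a \<in> A \<Longrightarrow>
      cell_index delta (mu a k) (nu a k) \<and>
      cell (mu a k) (nu a k) \<subseteq> xi (ret a k) ` part_elem (P (ret a k)) a \<and>
      xi (ret a k) ` part_elem (P (ret a k)) a \<subseteq> cell_plus (mu a k) (nu a k)"
    and bound_period: "a \<in> A \<Longrightarrow>
      bound_period_length alpha (part_elem (P (ret a k)) a) (mu a k) (p a k)"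
    \<comment> \<open>The next essential free return is the first free time at which a cell is covered.\<close>
    and next_ret: "a \<in> A \<Longrightarrow>
      ret a k + p a k \<le> ret a (Suc k) \<and>
      covers_cell delta (xi (ret a (Suc k)) ` part_elem (P (ret a k)) a) \<and>
      (\<forall>j. ret a k + p a k \<le> j \<and> j < ret a (Suc k) \<longrightarrow>
           \<not> covers_cell delta (xi j ` part_elem (P (ret a k)) a))"
    \<comment> \<open>Inessential free returns are followed by bound periods as well.\<close>
    and inessential: "a \<in> A \<Longrightarrow> ret a k + p a k \<le> j \<Longrightarrow> j < ret a (Suc k) \<Longrightarrow>
      xi j ` part_elem (P (ret a k)) a \<inter> {- delta<..<delta} \<noteq> {} \<Longrightarrow>
      cell_index delta \<mu> \<nu> \<Longrightarrow> xi j ` part_elem (P (ret a k)) a \<subseteq> cell_plus \<mu> \<nu> \<Longrightarrow>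
      \<exists>q. bound_period_length alpha (part_elem (P (ret a k)) a) \<mu> q"
    and infinitely_many_escapes: "a \<in> A \<Longrightarrow>
      infinite {k. escapes delta (part_elem (P (ret a k - 1)) a) (ret a k)}"

end

theory Submission
  imports Defs
begin

text \<open>At an escape time \<open>n\<close> the interval \<open>xi n ` \<omega>\<close> contains \<open>[\<delta>\<^sup>2, \<delta>/3]\<close> up to sign, where \<open>\<omega>\<close> is
  an arbitrarily short parameter interval around \<open>a\<close>. The map \<open>quad 2\<close> is conjugate to angle
  doubling, so some iterate \<open>M = M(\<delta>)\<close> takes both values \<open>1\<close> and \<open>-1\<close> on \<open>[\<delta>\<^sup>2, \<delta>/3]\<close>; for
  parameters close enough to \<open>2\<close>, depending on \<open>\<delta>\<close>, this remains almost true. Hence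
  \<open>xi (n + M)\<close> crosses, on \<open>\<omega>\<close>, every continuous curve staying in \<open>(-9/10, 9/10)\<close>. Following a
  backward orbit of \<open>z\<close> in \<open>\<Gamma>\<close> one finds a point of \<open>\<Gamma>\<close> in \<open>(-4/5, 4/5)\<close> that is mapped to \<open>z\<close>,
  and the crossing with its continuation yields the desired parameter. The backward orbit could
  only avoid \<open>(-4/5, 4/5)\<close> by converging to the fixed point \<open>-1\<close> of \<open>quad 2\<close>, which has no
  continuation to parameters \<open>b < 2\<close> inside \<open>[-1, 1]\<close>.\<close>

section \<open>Iterates of the quadratic family and their values near parameter 2\<close>

lemma quad_minus [simp]: "quad a (- x) = quad a x"
  by (simp add: quad_def)

lemma quad_funpow_minus:
  assumes "0 < M"
  shows "(quad a ^^ M) (- x) = (quad a ^^ M) x"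
  using assms by (cases M) (simp_all add: funpow_Suc_right del: funpow.simps)

lemma xi_add: "xi (n + M) b = (quad b ^^ M) (xi n b)"
  by (simp add: xi_def add.commute[of n] funpow_add)

lemma continuous_on_quad_funpow:
  assumes "continuous_on S g"
  shows "continuous_on S (\<lambda>b. (quad b ^^ M) (g b))"
  using assms by (induction M) (auto simp: quad_def intro!: continuous_intros)

lemma continuous_on_xi: "continuous_on S (xi n)"
  unfolding xi_def by (intro continuous_on_quad_funpow continuous_on_const)

text \<open>The double angle formula gives \<open>quad 2 (cos t) = - cos (2 * t)\<close>, and
  evenness of \<open>quad 2\<close> absorbs the sign at each later step. Zero iterates would give
  the opposite sign, hence \<open>Suc n\<close>.\<close>

lemma quad_2_funpow_cos: "(quad 2 ^^ Suc n) (cos t) = - cos (2 ^ Suc n * t)"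
proof (induction n)
  case 0
  show ?case by (simp add: quad_def cos_double_cos)
next
  case (Suc n)
  have "(quad 2 ^^ Suc (Suc n)) (cos t) = quad 2 (- cos (2 ^ Suc n * t))"
    using Suc by simp
  also have "\<dots> = - cos (2 * (2 ^ Suc n * t))"
    by (subst cos_double_cos) (simp add: quad_def)
  finally show ?case by (simp add: mult.assoc)
qed

text \<open>In the angle coordinate the interval is stretched by \<open>2 ^ Suc n\<close>. Once
  longer than \<open>3 * pi\<close> it contains an even multiple of \<open>pi\<close> and the odd
  multiple after it, where \<open>- cos\<close> is \<open>-1\<close> and \<open>1\<close>.\<close>

lemma quad_2_funpow_full:
  assumes "0 < l" "l < r" "r < 1"
  obtains M u v where "0 < M" "u \<in> {l..r}" "v \<in> {l..r}"
    "(quad 2 ^^ M) u = -1" "(quad 2 ^^ M) v = 1"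
proof -
  define L where "L = arccos l - arccos r"
  have "arccos r < arccos l"
    using assms by (intro arccos_less_arccos) auto
  then have "L > 0" by (simp add: L_def)
  obtain n :: nat where "3 * pi / L < 2 ^ n"
    using real_arch_pow[of 2 "3 * pi / L"] by auto
  also have "(2::real) ^ n \<le> 2 ^ Suc n" by simp
  finally have n: "3 * pi < 2 ^ Suc n * L"
    using \<open>L > 0\<close> by (simp add: pos_divide_less_eq)
  define c where "c = 2 ^ Suc n * arccos r"
  \<comment> \<open>The first multiple of \<open>2 * pi\<close> from \<open>c\<close> on lies below
    \<open>c + 2 * pi\<close>, so adding \<open>pi\<close> stays below
    \<open>c + 3 * pi\<close>.\<close>
  define k where "k = \<lceil>c / (2 * pi)\<rceil>"
  have "c / (2 * pi) \<le> k" "k < c / (2 * pi) + 1"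
    unfolding k_def by linarith+
  then have k: "c \<le> 2 * pi * k" "2 * pi * k < c + 2 * pi"
    by (simp_all add: field_simps)
  have top: "c + 3 * pi < 2 ^ Suc n * arccos l"
    using n by (simp add: c_def L_def algebra_simps)
  have in_range: "cos (s / 2 ^ Suc n) \<in> {l..r}" if "c \<le> s" "s \<le> c + 3 * pi" for s
  proof -
    have "arccos r \<le> s / 2 ^ Suc n" "s / 2 ^ Suc n \<le> arccos l"
      using that top by (simp_all add: c_def field_simps)
    moreover have "0 \<le> arccos r" "arccos l \<le> pi"
      using assms by (auto intro: arccos_lbound arccos_ubound)
    ultimately have "cos (arccos l) \<le> cos (s / 2 ^ Suc n)" "cos (s / 2 ^ Suc n) \<le> cos (arccos r)"
      by (auto intro!: cos_monotone_0_pi_le)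
    then show ?thesis using assms by (simp add: cos_arccos)
  qed
  have val: "(quad 2 ^^ Suc n) (cos (s / 2 ^ Suc n)) = - cos s" for s
    by (subst quad_2_funpow_cos) simp
  show ?thesis
  proof (rule that)
    show "cos (2 * pi * k / 2 ^ Suc n) \<in> {l..r}"
      by (rule in_range) (use k pi_gt_zero in linarith)+
    show "cos ((2 * pi * k + pi) / 2 ^ Suc n) \<in> {l..r}"
      by (rule in_range) (use k pi_gt_zero in linarith)+
    show "(quad 2 ^^ Suc n) (cos (2 * pi * k / 2 ^ Suc n)) = -1"
      unfolding val by (simp add: cos_int_2pin)
    show "(quad 2 ^^ Suc n) (cos ((2 * pi * k + pi) / 2 ^ Suc n)) = 1"
      unfolding val by (simp add: cos_int_2pin)
  qed simp
qed

lemma quad_funpow_near_2: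
  assumes "e > 0"
  obtains d where "d > 0" "\<And>b. \<bar>b - 2\<bar> < d \<Longrightarrow> \<bar>(quad b ^^ M) x - (quad 2 ^^ M) x\<bar> < e"
proof -
  have "continuous_on UNIV (\<lambda>b. (quad b ^^ M) x)"
    by (intro continuous_on_quad_funpow continuous_on_const)
  then show ?thesis
    using assms that unfolding continuous_on_iff dist_real_def by blast
qed

section \<open>Negative fixed points and backward orbits in hyperbolic sets\<close>

lemma quad_fixpoint_le_neg:
  assumes "0 < b" "b \<le> 2" "-1 \<le> x" "x < 0" "quad b x = x"
  shows "b = 2 \<and> x = -1"
proof -
  have "b * x\<^sup>2 \<le> 2 * x\<^sup>2" using assms by (intro mult_right_mono) auto
  \<comment> \<open>At a fixed point \<open>b * x\<^sup>2 = 1 - x\<close>, and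
    \<open>1 - x - 2 * x\<^sup>2\<close> factors this way.\<close>
  then have "(1 + x) * (1 - 2 * x) \<le> 0"
    using assms(5) by (simp add: quad_def algebra_simps power2_eq_square)
  moreover have "1 - 2 * x > 0" using assms by simp
  ultimately have "1 + x \<le> 0" by (metis mult_pos_pos not_le)
  then have "x = -1" using assms by simp
  then show ?thesis using assms by (simp add: quad_def)
qed

lemma quad_ge_self:
  assumes "0 < b" "b \<le> 2" "-1 \<le> x" "x \<le> 0"
  shows "x \<le> quad b x"
proof -
  have "b * x\<^sup>2 \<le> 2 * x\<^sup>2" using assms by (intro mult_right_mono) auto
  moreover have "0 \<le> (1 + x) * (1 - 2 * x)" using assms by (intro mult_nonneg_nonneg) auto
  ultimately show ?thesis by (simp add: quad_def algebra_simps power2_eq_square)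
qed

text \<open>By the conjugacy, \<open>-1\<close> would continue to a fixed point of
  \<open>quad b\<close> that is negative by continuity and at least \<open>-1\<close> by definition
  of a hyperbolic set. \<open>U\<close> contains parameters \<open>b < 2\<close>, for which no such
  fixed point exists.\<close>

lemma fixpoint_not_continued:
  assumes "continuation 2 \<Gamma> U h" "hyperbolic_set 2 \<Gamma>"
  shows "-1 \<notin> \<Gamma>"
proof
  assume m: "-1 \<in> \<Gamma>"
  have U: "openin (top_of_set {0<..2}) U" "2 \<in> U"
    and cont: "continuous_on (U \<times> \<Gamma>) (\<lambda>(b, x). h b x)" and h2: "h 2 (-1) = -1"
    and hyp: "\<And>b. b \<in> U \<Longrightarrow> hyperbolic_set b (h b ` \<Gamma>)"
    and conj: "\<And>b. b \<in> U \<Longrightarrow> h b (quad 2 (-1)) = quad b (h b (-1))"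
    using assms(1) m unfolding continuation_def by blast+
  have "continuous_on U (\<lambda>b. (\<lambda>(b, x). h b x) (b, -1))"
    by (rule continuous_on_compose2[OF cont]) (use m in \<open>auto intro!: continuous_intros\<close>)
  then obtain d1 where d1: "d1 > 0" "\<And>b. b \<in> U \<Longrightarrow> dist b 2 < d1 \<Longrightarrow> dist (h b (-1)) (h 2 (-1)) < 1"
    unfolding continuous_on_iff using \<open>2 \<in> U\<close> by (metis case_prod_conv zero_less_one)
  obtain d2 where d2: "d2 > 0" "\<And>b. b \<in> {0<..2} \<Longrightarrow> dist b 2 < d2 \<Longrightarrow> b \<in> U"
    using U unfolding openin_euclidean_subtopology_iff by blast
  define b where "b = 2 - min 1 (min d1 d2) / 2"
  have b: "0 < b" "b < 2" "dist b 2 < d1" "dist b 2 < d2"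
    using d1(1) d2(1) by (auto simp: b_def dist_real_def)
  then have "b \<in> U" using d2(2) by auto
  then have "h b (-1) < 0" using d1(2) b h2 by (force simp: dist_real_def)
  moreover have "h b (-1) \<ge> -1"
    using hyp[OF \<open>b \<in> U\<close>] m unfolding hyperbolic_set_def by auto
  moreover have "quad b (h b (-1)) = h b (-1)"
    using conj[OF \<open>b \<in> U\<close>] by (simp add: quad_def)
  ultimately show False using quad_fixpoint_le_neg[of b "h b (-1)"] b by simp
qed

lemma hyperbolic_set_central_preimage:
  assumes hyp: "hyperbolic_set a \<Gamma>" and cont: "continuation a \<Gamma> U h" and "z \<in> \<Gamma>"
    and a: "8/5 < a" "a \<le> 2"
  obtains y m where "y \<in> \<Gamma>" "\<bar>y\<bar> < 4/5" "(quad a ^^ m) y = z"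
proof (rule ccontr)
  assume none: "\<not> thesis"
  have \<Gamma>: "\<Gamma> \<subseteq> {-1..1}" "compact \<Gamma>" "quad a ` \<Gamma> = \<Gamma>"
    using hyp unfolding hyperbolic_set_def by auto
  \<comment> \<open>A choice of preimages inside \<open>\<Gamma>\<close>; iterating it yields the
    backward orbit \<open>s\<close> of \<open>z\<close>.\<close>
  define g where "g x = (SOME w. w \<in> \<Gamma> \<and> quad a w = x)" for x
  have g: "g x \<in> \<Gamma> \<and> quad a (g x) = x" if "x \<in> \<Gamma>" for x
    unfolding g_def by (rule someI_ex) (use that \<Gamma>(3) in force)
  define s where "s n = (g ^^ n) z" for n
  have s_in: "s n \<in> \<Gamma>" for n
    by (induction n) (use g \<open>z \<in> \<Gamma>\<close> in \<open>auto simp: s_def\<close>)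
  have s_step: "quad a (s (Suc n)) = s n" for n
    using g[OF s_in[of n]] by (simp add: s_def)
  have "(quad a ^^ n) (s n) = z" for n
  proof (induction n)
    case (Suc n)
    then show ?case using s_step[of n] by (simp add: funpow_Suc_right del: funpow.simps)
  qed (simp add: s_def)
  then have far: "\<bar>s n\<bar> \<ge> 4/5" for n
    using none that s_in by (meson not_le)
  \<comment> \<open>A point of modulus at least \<open>4/5\<close> has image at most
    \<open>1 - 128/125 < 0\<close>, and \<open>s n\<close> is the image of \<open>s (Suc n)\<close>.
    On negative points \<open>quad_ge_self\<close> then makes \<open>s\<close> monotone.\<close>
  have neg: "s n < 0" for n
  proof -
    have "(4/5)\<^sup>2 \<le> \<bar>s (Suc n)\<bar>\<^sup>2" using far by (intro power_mono) auto
    then have "8/5 * (16/25) \<le> a * (s (Suc n))\<^sup>2"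
      using a by (intro mult_mono) (auto simp: power2_eq_square)
    then show ?thesis using s_step[of n] by (simp add: quad_def)
  qed
  have bounds: "-1 \<le> s n" for n using s_in \<Gamma>(1) by force
  have "s (Suc n) \<le> s n" for n
    using quad_ge_self[of a "s (Suc n)"] s_step[of n] neg[of "Suc n"] bounds[of "Suc n"] a by simp
  then have "decseq s" by (intro decseq_SucI)
  then obtain L where L: "s \<longlonglongrightarrow> L"
    using decseq_convergent[of s "-1"] bounds by metis
  have "L \<in> \<Gamma>"
    using closed_sequentially[OF compact_imp_closed[OF \<Gamma>(2)]] s_in L by blast
  have "(\<lambda>n. quad a (s (Suc n))) \<longlonglongrightarrow> quad a L"
    unfolding quad_def by (intro tendsto_intros LIMSEQ_Suc L)
  then have "quad a L = L" using s_step L LIMSEQ_unique by simp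
  moreover have "L < 0"
  proof -
    have "s n \<le> -4/5" for n using far[of n] neg[of n] by simp
    then have "L \<le> -4/5" using L by (intro LIMSEQ_le_const2) auto
    then show ?thesis by simp
  qed
  moreover have "-1 \<le> L" using \<open>L \<in> \<Gamma>\<close> \<Gamma>(1) by auto
  ultimately have "a = 2" "L = -1" using quad_fixpoint_le_neg[of a L] a by auto
  then show False using fixpoint_not_continued cont hyp \<open>L \<in> \<Gamma>\<close> by blast
qed

section \<open>Escape times: long images of short parameter intervals\<close>

lemma interval_large_measure_meets_zero:
  fixes S :: "real set"
  assumes "is_interval S" "S \<inter> {- l<..<l} \<noteq> {}" "2 * r < len S" "0 < r"
  shows "{l..r} \<subseteq> S \<or> uminus ` {l..r} \<subseteq> S"
proof -
  \<comment> \<open>Inside \<open>[-r, r]\<close> the length would be at most \<open>2 * r\<close>.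
    Joining \<open>s\<close> to a point of modulus below \<open>l\<close> covers one of the two
    intervals, according to the sign of \<open>s\<close>.\<close>
  have "\<exists>s\<in>S. r < \<bar>s\<bar>"
  proof (rule ccontr)
    assume "\<not> ?thesis"
    then have "S \<subseteq> {-r..r}" by (auto simp: abs_le_iff not_less)
    then have "len S \<le> len {-r..r}"
      using real_interval_borel_measurable[OF assms(1)] fmeasurable_cbox(1)[of "-r" r]
      by (intro measure_mono_fmeasurable) auto
    then show False using assms by simp
  qed
  then obtain s where s: "s \<in> S" "r < \<bar>s\<bar>" by blast
  obtain c where c: "c \<in> S" "- l < c" "c < l" using assms(2) by auto
  have conv: "x \<in> S" if "p \<in> S" "q \<in> S" "p \<le> x" "x \<le> q" for p q x
    using assms(1) that unfolding is_interval_1 by blast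
  show ?thesis
  proof (cases "s > 0")
    case True
    then show ?thesis using conv[of c s] c s by auto
  next
    case False
    then show ?thesis using conv[of s c] c s by auto
  qed
qed

context benedicks_carleson
begin

lemma part_elem_props:
  assumes "a \<in> An n"
  shows "part_elem (P n) a \<in> P n" "a \<in> part_elem (P n) a" "part_elem (P n) a \<subseteq> An n"
proof -
  have "\<exists>!\<omega>. \<omega> \<in> P n \<and> a \<in> \<omega>"
    using assms partition_onD1[OF partition[of n]] disjointD[OF partition_onD2[OF partition[of n]]]
    by (metis Union_iff disjoint_iff)
  then have "part_elem (P n) a \<in> P n \<and> a \<in> part_elem (P n) a"
    unfolding part_elem_def by (rule theI')
  then show "part_elem (P n) a \<in> P n" "a \<in> part_elem (P n) a" "part_elem (P n) a \<subseteq> An n"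
    using partition_onD1[OF partition[of n]] by auto
qed

lemma part_elem_antimono:
  assumes "a \<in> A" "m \<le> n"
  shows "part_elem (P n) a \<subseteq> part_elem (P m) a"
  using assms(2)
proof (induction n rule: dec_induct)
  case (step n)
  then show ?case using nested[of a n] assms(1) A_eq by blast
qed simp

text \<open>Nested intervals around \<open>a\<close> with intersection \<open>{a}\<close> eventually
  omit both \<open>a - d\<close> and \<open>a + d\<close>; being intervals, they then lie strictly
  between.\<close>

lemma part_elem_small:
  assumes a: "a \<in> A" and "d > 0"
  obtains n0 where "\<And>n. n0 \<le> n \<Longrightarrow> part_elem (P n) a \<subseteq> {a - d<..<a + d}"
proof -
  have aA: "a \<in> An n" for n using a A_eq by auto
  have conv: "x \<in> part_elem (P n) a"
    if "p \<in> part_elem (P n) a" "q \<in> part_elem (P n) a" "p \<le> x" "x \<le> q" for n p q x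
    using partition_intervals[OF part_elem_props(1)[OF aA]] that
    unfolding is_interval_1 by blast
  have "a + d \<notin> (\<Inter>n. part_elem (P n) a)" "a - d \<notin> (\<Inter>n. part_elem (P n) a)"
    using shrinking[OF a] \<open>d > 0\<close> by auto
  then obtain n1 n2 where n: "a + d \<notin> part_elem (P n1) a" "a - d \<notin> part_elem (P n2) a"
    by blast
  show ?thesis
  proof (rule that[of "max n1 n2"], rule subsetI)
    fix n b assume "max n1 n2 \<le> n" and b: "b \<in> part_elem (P n) a"
    then have "a + d \<notin> part_elem (P n) a" "a - d \<notin> part_elem (P n) a"
      using n part_elem_antimono[OF a, of n1 n] part_elem_antimono[OF a, of n2 n] by auto
    then have "\<not> a + d \<le> b" "\<not> b \<le> a - d"
      using conv[of a n b "a + d"] conv[of b n a "a - d"] b part_elem_props(2)[OF aA] \<open>d > 0\<close>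
      by auto
    then show "b \<in> {a - d<..<a + d}" by auto
  qed
qed

lemma escape_in_small_interval:
  assumes a: "a \<in> A" and "d > 0" "0 < delta"
  obtains \<omega> n where "is_interval \<omega>" "a \<in> \<omega>" "\<omega> \<subseteq> {a - d<..<a + d}"
    "\<omega> \<subseteq> {0<..2} \<inter> {2 - eps<..2}"
    "{delta\<^sup>2..delta/3} \<subseteq> xi n ` \<omega> \<or> uminus ` {delta\<^sup>2..delta/3} \<subseteq> xi n ` \<omega>"
proof -
  have aA: "a \<in> An n" for n using a A_eq by auto
  obtain n0 where n0: "\<And>n. n0 \<le> n \<Longrightarrow> part_elem (P n) a \<subseteq> {a - d<..<a + d}"
    using part_elem_small[OF a \<open>d > 0\<close>] by blast
  \<comment> \<open>\<open>Suc n0\<close> makes up for the element being taken at time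
    \<open>ret a k - 1\<close>, before the subdivision at the return.\<close>
  obtain k where k: "Suc n0 \<le> k" "escapes delta (part_elem (P (ret a k - 1)) a) (ret a k)"
    using infinitely_many_escapes[OF a] unfolding infinite_nat_iff_unbounded_le by blast
  define \<omega> where "\<omega> = part_elem (P (ret a k - 1)) a"
  have "k \<le> ret a k" using strict_mono_imp_increasing[OF ret_strict_mono[OF a]] by blast
  then have small: "\<omega> \<subseteq> {a - d<..<a + d}" using n0[of "ret a k - 1"] k(1) by (simp add: \<omega>_def)
  have int: "is_interval \<omega>"
    unfolding \<omega>_def by (rule partition_intervals[OF part_elem_props(1)[OF aA]])
  then have "is_interval (xi (ret a k) ` \<omega>)"
    unfolding is_interval_connected_1
    by (intro connected_continuous_image continuous_on_xi)
  \<comment> \<open>Escape only gives length at least \<open>delta\<close>, while the strict bound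
    \<open>2 * r < len S\<close> is required; \<open>r = delta / 3\<close> provides it.\<close>
  moreover have "2 * (delta / 3) < len (xi (ret a k) ` \<omega>)"
    using k(2) \<open>0 < delta\<close> unfolding escapes_def \<omega>_def[symmetric] by linarith
  moreover have "xi (ret a k) ` \<omega> \<inter> {- (delta\<^sup>2)<..<delta\<^sup>2} \<noteq> {}"
    using k(2) unfolding escapes_def \<omega>_def by blast
  ultimately have "{delta\<^sup>2..delta/3} \<subseteq> xi (ret a k) ` \<omega> \<or> uminus ` {delta\<^sup>2..delta/3} \<subseteq> xi (ret a k) ` \<omega>"
    using \<open>0 < delta\<close> by (intro interval_large_measure_meets_zero) auto
  moreover have "\<omega> \<subseteq> {0<..2} \<inter> {2 - eps<..2}"
    unfolding \<omega>_def using part_elem_props(3)[OF aA] An_near_2 by blast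
  ultimately show ?thesis
    using that[OF int _ small] part_elem_props(2)[OF aA] unfolding \<omega>_def by blast
qed

end

section \<open>Crossing the continuation of a point of the hyperbolic set\<close>

lemma crossing:
  fixes \<phi> \<psi> :: "real \<Rightarrow> real"
  assumes "is_interval \<omega>" "continuous_on \<omega> \<phi>" "continuous_on \<omega> \<psi>"
    and "b1 \<in> \<omega>" "b2 \<in> \<omega>" "\<phi> b1 \<le> \<psi> b1" "\<psi> b2 \<le> \<phi> b2"
  obtains b where "b \<in> \<omega>" "\<phi> b = \<psi> b"
proof -
  let ?f = "\<lambda>b. \<phi> b - \<psi> b"
  have "is_interval (?f ` \<omega>)"
    using assms(1-3) unfolding is_interval_connected_1
    by (intro connected_continuous_image continuous_intros)
  moreover have "?f b1 \<in> ?f ` \<omega>" "?f b2 \<in> ?f ` \<omega>" using assms by auto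
  ultimately have "0 \<in> ?f ` \<omega>"
    unfolding is_interval_1 using assms by (meson diff_ge_0_iff_ge diff_le_0_iff_le)
  then show ?thesis using that by auto
qed

text \<open>The full-range property enters only through \<open>cover\<close>, and
  \<open>eps \<le> 2/5\<close> puts \<open>a\<close> above the threshold \<open>8/5\<close> for
  central preimages.\<close>

lemma (in benedicks_carleson) closure_of_hits:
  assumes delta: "0 < delta"
    and uv: "u \<in> {delta\<^sup>2..delta/3}" "v \<in> {delta\<^sup>2..delta/3}" "0 < M"
    and cover: "\<And>b. 2 - eps < b \<Longrightarrow> b \<le> 2 \<Longrightarrow> (quad b ^^ M) u < -9/10 \<and> 9/10 < (quad b ^^ M) v"
    and eps: "eps \<le> 2/5"
    and a: "a \<in> A" and hyp: "hyperbolic_set a \<Gamma>" and "z \<in> \<Gamma>" and cont: "continuation a \<Gamma> U h"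
  shows "a \<in> closure {b \<in> U. \<exists>N. (quad b ^^ N) 0 = h b z}"
proof (unfold closure_approachable, intro allI impI)
  fix e :: real assume "e > 0"
  have "a \<in> An 0" using a A_eq by auto
  then have "8/5 < a" "a \<le> 2" using An_near_2[of 0] eps by force+
  then obtain y m where y: "y \<in> \<Gamma>" "\<bar>y\<bar> < 4/5" "(quad a ^^ m) y = z"
    using hyperbolic_set_central_preimage[OF hyp cont \<open>z \<in> \<Gamma>\<close>] by blast
  have U: "openin (top_of_set {0<..2}) U" "a \<in> U"
    and h: "continuous_on (U \<times> \<Gamma>) (\<lambda>(b, x). h b x)" "\<And>x. x \<in> \<Gamma> \<Longrightarrow> h a x = x"
    and conj: "\<And>b x. b \<in> U \<Longrightarrow> x \<in> \<Gamma> \<Longrightarrow> h b (quad a x) = quad b (h b x)"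
    using cont unfolding continuation_def by blast+
  have \<Gamma>: "quad a x \<in> \<Gamma>" if "x \<in> \<Gamma>" for x
    using hyp that unfolding hyperbolic_set_def by blast
  have "continuous_on U (\<lambda>b. (\<lambda>(b, x). h b x) (b, y))"
    by (rule continuous_on_compose2[OF h(1)]) (use y in \<open>auto intro!: continuous_intros\<close>)
  then have hy: "continuous_on U (\<lambda>b. h b y)" by simp
  \<comment> \<open>\<open>1/10\<close> is the gap between \<open>4/5\<close>, which bounds
    \<open>y\<close>, and the level \<open>9/10\<close> of \<open>cover\<close>.\<close>
  then obtain d1 where d1: "d1 > 0" "\<And>b. b \<in> U \<Longrightarrow> dist b a < d1 \<Longrightarrow> dist (h b y) (h a y) < 1/10"
    unfolding continuous_on_iff using \<open>a \<in> U\<close> by (metis zero_less_divide_1_iff zero_less_numeral)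
  obtain d2 where d2: "d2 > 0" "\<And>b. b \<in> {0<..2} \<Longrightarrow> dist b a < d2 \<Longrightarrow> b \<in> U"
    using U unfolding openin_euclidean_subtopology_iff by blast
  define d where "d = min e (min d1 d2)"
  have "d > 0" using \<open>e > 0\<close> d1 d2 by (simp add: d_def)
  obtain \<omega> n where int: "is_interval \<omega>" and small: "\<omega> \<subseteq> {a - d<..<a + d}"
    and near: "\<omega> \<subseteq> {0<..2} \<inter> {2 - eps<..2}"
    and esc: "{delta\<^sup>2..delta/3} \<subseteq> xi n ` \<omega> \<or> uminus ` {delta\<^sup>2..delta/3} \<subseteq> xi n ` \<omega>"
    by (rule escape_in_small_interval[OF a \<open>d > 0\<close> delta])
  have dist: "dist b a < d" if "b \<in> \<omega>" for b
    using subsetD[OF small that] by (simp add: dist_real_def abs_less_iff)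
  have \<omega>U: "\<omega> \<subseteq> U" using dist near d2 by (force simp: d_def)
  have hb: "\<bar>h b y\<bar> \<le> 9/10" if "b \<in> \<omega>" for b
  proof -
    have "dist (h b y) y < 1/10"
      using d1(2)[of b] dist[OF that] that \<omega>U h(2)[OF y(1)] by (auto simp: d_def)
    then show ?thesis using y(2) unfolding dist_real_def by linarith
  qed
  \<comment> \<open>Whichever sign occurs at the escape, evenness and \<open>0 < M\<close> give
    \<open>w\<close> and \<open>- w\<close> the same image.\<close>
  have attained: "\<exists>b\<in>\<omega>. xi (n + M) b = (quad b ^^ M) w" if "w \<in> {delta\<^sup>2..delta/3}" for w
  proof -
    have "w \<in> xi n ` \<omega> \<or> - w \<in> xi n ` \<omega>"
      using esc subsetD[OF _ that] subsetD[OF _ imageI[OF that]] by metis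
    then obtain b where "b \<in> \<omega>" "xi n b = w \<or> xi n b = - w"
      by (elim disjE imageE) simp_all
    then have "xi (n + M) b = (quad b ^^ M) w"
      using quad_funpow_minus[OF uv(3), of b w] by (auto simp: xi_add)
    then show ?thesis using \<open>b \<in> \<omega>\<close> by blast
  qed
  obtain b1 b2 where b12: "b1 \<in> \<omega>" "xi (n + M) b1 = (quad b1 ^^ M) u"
    "b2 \<in> \<omega>" "xi (n + M) b2 = (quad b2 ^^ M) v"
    using attained uv by blast
  have "xi (n + M) b1 \<le> h b1 y"
    using cover[of b1] hb[OF b12(1)] subsetD[OF near b12(1)] b12(2) by (auto simp: abs_le_iff)
  moreover have "h b2 y \<le> xi (n + M) b2"
    using cover[of b2] hb[OF b12(3)] subsetD[OF near b12(3)] b12(4) by (auto simp: abs_le_iff)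
  ultimately obtain b where b: "b \<in> \<omega>" "xi (n + M) b = h b y"
    using crossing[OF int continuous_on_xi continuous_on_subset[OF hy \<omega>U]] b12 by blast
  \<comment> \<open>The conjugacy carries the hit at \<open>h b y\<close> forward \<open>m\<close>
    steps to a hit at \<open>h b z\<close>.\<close>
  have "(quad a ^^ i) y \<in> \<Gamma> \<and> h b ((quad a ^^ i) y) = (quad b ^^ i) (h b y)" for i
    by (induction i) (use y \<Gamma> conj b \<omega>U in auto)
  then have "h b z = xi (n + M + m) b"
    using y(3) b(2) xi_add[of "n + M" m b] by metis
  then have "(quad b ^^ (n + M + m)) 0 = h b z" by (simp add: xi_def)
  then show "\<exists>b\<in>{b \<in> U. \<exists>N. (quad b ^^ N) 0 = h b z}. dist b a < e"
    using b(1) \<omega>U dist[OF b(1)] by (auto simp: d_def)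
qed

theorem theoremB:
  fixes lam :: real
  assumes "lam > 0"
  shows "\<forall>\<^sub>F alpha in at_right 0. \<forall>\<^sub>F delta in at_right 0. \<forall>\<^sub>F eps in at_right 0.
    \<forall>A An P ret mu nu p a \<Gamma> z U h.
      benedicks_carleson lam alpha delta eps A An P ret mu nu p \<longrightarrow>
      a \<in> A \<longrightarrow> hyperbolic_set a \<Gamma> \<longrightarrow> z \<in> \<Gamma> \<longrightarrow> continuation a \<Gamma> U h \<longrightarrow>
      a \<in> closure {b \<in> U. \<exists>N. (quad b ^^ N) 0 = h b z}"
proof -
  have "\<exists>e>0. \<forall>eps>0. eps < e \<longrightarrow> (\<forall>A An P ret mu nu p a \<Gamma> z U h.
      benedicks_carleson lam alpha delta eps A An P ret mu nu p \<longrightarrow>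
      a \<in> A \<longrightarrow> hyperbolic_set a \<Gamma> \<longrightarrow> z \<in> \<Gamma> \<longrightarrow> continuation a \<Gamma> U h \<longrightarrow>
      a \<in> closure {b \<in> U. \<exists>N. (quad b ^^ N) 0 = h b z})"
    if "0 < delta" "delta < 1/3" for alpha delta :: real
  proof -
    \<comment> \<open>\<open>delta < 1/3\<close> is what makes
      \<open>[delta\<^sup>2, delta/3]\<close> nondegenerate. \<open>M\<close>, \<open>u\<close>,
      \<open>v\<close> depend on \<open>delta\<close> alone, so \<open>eps\<close> can be chosen
      after them.\<close>
    have "0 < delta\<^sup>2" "delta\<^sup>2 < delta / 3" "delta / 3 < 1"
      using that by (simp_all add: power2_eq_square field_simps)
    from quad_2_funpow_full[OF this] obtain M u v where uv: "0 < M" "u \<in> {delta\<^sup>2..delta/3}" "v \<in> {delta\<^sup>2..delta/3}"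
      "(quad 2 ^^ M) u = -1" "(quad 2 ^^ M) v = 1"
      by blast
    obtain d1 where d1: "d1 > 0"
      "\<And>b. \<bar>b - 2\<bar> < d1 \<Longrightarrow> \<bar>(quad b ^^ M) u - (quad 2 ^^ M) u\<bar> < 1/10"
      using quad_funpow_near_2[of "1/10" M u] by auto
    obtain d2 where d2: "d2 > 0"
      "\<And>b. \<bar>b - 2\<bar> < d2 \<Longrightarrow> \<bar>(quad b ^^ M) v - (quad 2 ^^ M) v\<bar> < 1/10"
      using quad_funpow_near_2[of "1/10" M v] by auto
    have cover: "(quad b ^^ M) u < -9/10 \<and> 9/10 < (quad b ^^ M) v"
      if "eps < min d1 d2" "2 - eps < b" "b \<le> 2" for eps b
    proof -
      have "\<bar>b - 2\<bar> < d1" "\<bar>b - 2\<bar> < d2" using that by auto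
      from d1(2)[OF this(1)] d2(2)[OF this(2)] show ?thesis
        unfolding uv(4,5) by linarith
    qed
    show ?thesis
    \<comment> \<open>\<open>2/5\<close> serves the central preimage; \<open>d1\<close> and
      \<open>d2\<close> keep the \<open>M\<close>-th iterates of \<open>u\<close> and
      \<open>v\<close> within \<open>1/10\<close> of \<open>-1\<close> and \<open>1\<close>.\<close>
    proof (intro exI[of _ "min (2/5) (min d1 d2)"] conjI allI impI)
      show "0 < min (2/5) (min d1 d2)" using d1(1) d2(1) by simp
    next
      fix eps A An P ret mu nu p a \<Gamma> z U h
      assume eps: "eps < min (2/5) (min d1 d2)"
        and bc: "benedicks_carleson lam alpha delta eps A An P ret mu nu p"
        and rest: "a \<in> A" "hyperbolic_set a \<Gamma>" "z \<in> \<Gamma>" "continuation a \<Gamma> U h"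
      interpret benedicks_carleson lam alpha delta eps A An P ret mu nu p by (rule bc)
      show "a \<in> closure {b \<in> U. \<exists>N. (quad b ^^ N) 0 = h b z}"
        by (rule closure_of_hits[OF \<open>0 < delta\<close> uv(2,3,1) _ _ rest]) (use cover eps in auto)
    qed
  qed
  then have "\<forall>\<^sub>F delta in at_right 0. \<forall>\<^sub>F eps in at_right 0. \<forall>A An P ret mu nu p a \<Gamma> z U h.
      benedicks_carleson lam alpha delta eps A An P ret mu nu p \<longrightarrow>
      a \<in> A \<longrightarrow> hyperbolic_set a \<Gamma> \<longrightarrow> z \<in> \<Gamma> \<longrightarrow> continuation a \<Gamma> U h \<longrightarrow>
      a \<in> closure {b \<in> U. \<exists>N. (quad b ^^ N) 0 = h b z}" for alpha
    unfolding eventually_at_right_field by (intro exI[of _ "1/3"]) simp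
  then show ?thesis by (rule always_eventually[OF allI])
qed

end
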